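(* Let $A=A_1+A_2$ be the core-EP decomposition of $A\in\mathbb{C}_{n,n}$, where $A_1$ is the core-invertible part and $A_2$ is the nilpotent part, and let $k=\mathrm{Ind}(A)$. Then $$A^{(\dag)}=A^k\left(A^{k+1}\right)^{(\#)},\qquad AA^{(\dag)}=A^k\left(A^k\right)^{(\#)}=A^k\left(A^k\right)^\dag,$$ $$A_1=AA^{(\dag)}A,\qquad A_2=A-AA^{(\dag)}A.$$
   Context: $\mathbb{C}_{n,n}$ is the set of $n\times n$ complex matrices, $A^\ast$ is the conjugate transpose, $\mathrm{rk}$ the rank, $\mathcal{R}(A)$ the column space, $A^\dag$ the Moore-Penrose inverse. The index $\mathrm{Ind}(A)$ is $0$ if $A$ is non-singular, and otherwise is the smallest positive integer $k$ with $\mathrm{rk}(A^{k+1})=\mathrm{rk}(A^k)$. $\mathbb{C}_n^{\mathtt{CM}}=\{A\in\mathbb{C}_{n,n} : \mathrm{rk}(A^2)=\mathrm{rk}(A)\}$ (core-invertible matrices). Core-EP decomposition: for $A\in\mathbb{C}_{n,n}$ with $\mathrm{Ind}(A)=k$, it is the (existing and unique) decomposition $A=A_1+A_2$ with (i) $A_1\in\mathbb{C}_n^{\mathtt{CM}}$; (ii) $A_2^k=0$ (read as $A_2=0$ when $k=0$); (iii) $A_1^\ast A_2=A_2A_1=0$. Core inverse: for $A\in\mathbb{C}_n^{\mathtt{CM}}$, $A^{(\#)}$ is the unique $X\in\mathbb{C}_{n,n}$ with $AX=AA^\dag$ and $\mathcal{R}(X)\subseteq\mathcal{R}(A)$. (For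 $k=\mathrm{Ind}(A)$, both $A^k$ and $A^{k+1}$ lie in $\mathbb{C}_n^{\mathtt{CM}}$.) Core-EP inverse: for $A\in\mathbb{C}_{n,n}$ with $\mathrm{Ind}(A)=k$, $A^{(\dag)}$ is the unique $X\in\mathbb{C}_{n,n}$ satisfying $XA^{k+1}=A^k$, $XAX=X$, $(AX)^\ast=AX$ and $\mathcal{R}(X)\subseteq\mathcal{R}(A^k)$. *)

theory Defs
  imports "HOL-Analysis.Analysis"
begin

text \<open>
  Square complex matrices are elements of \<open>complex^'n^'n\<close>. The overloaded \<open>*\<close> and \<open>^\<close> on this type
  act componentwise, so the matrix product \<open>**\<close> and the matrix power below are used throughout.
\<close>

primrec mat_pow :: "complex^'n^'n \<Rightarrow> nat \<Rightarrow> complex^'n^'n" where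
  "mat_pow A 0 = mat 1"
| "mat_pow A (Suc m) = A ** mat_pow A m"

definition conj_transpose :: "complex^'n^'m \<Rightarrow> complex^'m^'n" where
  "conj_transpose A = transpose (map_matrix cnj A)"

text \<open>The span is the one over the complex scalars (\<open>vec.span\<close>), not the real span \<open>span\<close>.\<close>

definition col_space :: "complex^'n^'m \<Rightarrow> (complex^'m) set" where
  "col_space A = vec.span (columns A)"

definition mat_index :: "complex^'n^'n \<Rightarrow> nat" where
  "mat_index A =
     (if invertible A then 0
      else LEAST k. 0 < k \<and> rank (mat_pow A (k + 1)) = rank (mat_pow A k))"

definition core_invertible :: "complex^'n^'n \<Rightarrow> bool" where
  "core_invertible A \<longleftrightarrow> rank (mat_pow A 2) = rank A"

text \<open>
  Since the zeroth power is the identity, the condition \<open>A2^k = 0\<close> cannot be taken literally for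
  \<open>k = 0\<close>; there it means \<open>A2 = 0\<close>.
\<close>

definition core_EP_decomposition ::
    "complex^'n^'n \<Rightarrow> complex^'n^'n \<Rightarrow> complex^'n^'n \<Rightarrow> bool" where
  "core_EP_decomposition A A1 A2 \<longleftrightarrow>
     A = A1 + A2 \<and>
     core_invertible A1 \<and>
     (if mat_index A = 0 then A2 = 0 else mat_pow A2 (mat_index A) = 0) \<and>
     conj_transpose A1 ** A2 = 0 \<and>
     A2 ** A1 = 0"

text \<open>The four Penrose equations.\<close>

definition moore_penrose_inverse :: "complex^'n^'n \<Rightarrow> complex^'n^'n" where
  "moore_penrose_inverse A =
     (THE X. A ** X ** A = A \<and>
             X ** A ** X = X \<and>
             conj_transpose (A ** X) = A ** X \<and>
             conj_transpose (X ** A) = X ** A)"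

text \<open>Meaningful only for core-invertible \<open>A\<close>; otherwise no such \<open>X\<close> exists.\<close>

definition core_inverse :: "complex^'n^'n \<Rightarrow> complex^'n^'n" where
  "core_inverse A =
     (THE X. A ** X = A ** moore_penrose_inverse A \<and> col_space X \<subseteq> col_space A)"

definition core_EP_inverse :: "complex^'n^'n \<Rightarrow> complex^'n^'n" where
  "core_EP_inverse A =
     (THE X. X ** mat_pow A (mat_index A + 1) = mat_pow A (mat_index A) \<and>
             X ** A ** X = X \<and>
             conj_transpose (A ** X) = A ** X \<and>
             col_space X \<subseteq> col_space (mat_pow A (mat_index A)))"

end

theory Submission
  imports Defs
begin

text \<open>
  Since \<open>A2 ** A1 = 0\<close>, one has \<open>A\<^sup>m A1 = A1\<^sup>m\<^sup>+\<^sup>1\<close>, and the nilpotency of \<open>A2\<close> gives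
  \<open>A\<^sup>k = A1 U\<close> for some \<open>U\<close>. As \<open>A1\<close> is core-invertible, it follows that \<open>A1\<close>, \<open>A\<^sup>k\<close> and \<open>A\<^sup>k\<^sup>+\<^sup>1\<close> have
  the same column space. Let \<open>P\<close> be the orthogonal projector onto it. Then \<open>A1\<^sup>* A2 = 0\<close> says
  \<open>P A2 = 0\<close>, so \<open>P A = A1\<close>, and each of \<open>A A\<^sup>(\<^sup>\<dagger>\<^sup>)\<close>, \<open>A\<^sup>k (A\<^sup>k)\<^sup>(\<^sup>#\<^sup>)\<close>, \<open>A\<^sup>k (A\<^sup>k)\<^sup>\<dagger>\<close> equals \<open>P\<close>, because an
  orthogonal projector is determined by its range.
\<close>

section \<open>Column spaces and generalized inverses\<close>

lemma matrix_diff_ldistrib: "A ** (B - C) = A ** B - A ** C" for A :: "'a::ring_1^'n^'m"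
  by (simp add: matrix_matrix_mult_def vec_eq_iff right_diff_distrib sum_subtractf)

lemma matrix_add_rdistrib: "(B + C) ** A = B ** A + C ** A" for A :: "'a::semiring_1^'n^'m"
  by (simp add: matrix_matrix_mult_def vec_eq_iff distrib_right sum.distrib)

lemma conj_transpose_mult: "conj_transpose (A ** B) = conj_transpose B ** conj_transpose A"
  by (simp add: conj_transpose_def matrix_matrix_mult_def transpose_def vec_eq_iff mult.commute)

lemma conj_transpose_conj_transpose [simp]: "conj_transpose (conj_transpose A) = A"
  by (simp add: conj_transpose_def transpose_def vec_eq_iff)

text \<open>Diagonal entry \<open>j\<close> of the product is the squared norm of column
  \<open>j\<close> of \<open>A\<close>.\<close>

lemma conj_transpose_mult_self_eq_0:
  assumes "conj_transpose A ** A = 0"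
  shows "A = 0"
proof -
  have "A $ i $ j = 0" for i j
  proof -
    have "complex_of_real (\<Sum>l\<in>UNIV. (norm (A $ l $ j))\<^sup>2) =
        (\<Sum>l\<in>UNIV. A $ l $ j * cnj (A $ l $ j))"
      by (simp only: of_real_sum complex_norm_square)
    also have "\<dots> = (conj_transpose A ** A) $ j $ j"
      by (simp add: conj_transpose_def matrix_matrix_mult_def transpose_def mult.commute)
    finally have "complex_of_real (\<Sum>l\<in>UNIV. (norm (A $ l $ j))\<^sup>2) = 0"
      using assms by simp
    then have "(\<Sum>l\<in>UNIV. (norm (A $ l $ j))\<^sup>2) = 0"
      using of_real_eq_0_iff by blast
    then show ?thesis
      by (simp add: sum_nonneg_eq_0_iff)
  qed
  then show ?thesis
    by (simp add: vec_eq_iff)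
qed

text \<open>With \<open>D = U - V\<close>, the hypothesis makes the Gram matrix of
  \<open>A ** D\<close> vanish, hence \<open>A ** D\<close> itself.\<close>

lemma conj_transpose_mult_left_cancel:
  assumes "conj_transpose A ** A ** U = conj_transpose A ** A ** V"
  shows "A ** U = A ** V"
proof -
  have "conj_transpose (A ** (U - V)) ** (A ** (U - V)) =
      conj_transpose (U - V) ** (conj_transpose A ** A ** (U - V))"
    by (simp add: conj_transpose_mult matrix_mul_assoc)
  also have "\<dots> = 0"
    by (simp add: assms matrix_diff_ldistrib)
  finally have "A ** (U - V) = 0"
    by (rule conj_transpose_mult_self_eq_0)
  then show ?thesis
    by (simp add: matrix_diff_ldistrib)
qed

lemma conj_transpose_mult_right_cancel:
  assumes "U ** A ** conj_transpose A = V ** A ** conj_transpose A"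
  shows "U ** A = V ** A"
proof -
  have "conj_transpose (conj_transpose A) ** conj_transpose A ** conj_transpose U =
      conj_transpose (conj_transpose A) ** conj_transpose A ** conj_transpose V"
    using arg_cong[OF assms, of conj_transpose] by (simp add: conj_transpose_mult matrix_mul_assoc)
  then have "conj_transpose A ** conj_transpose U = conj_transpose A ** conj_transpose V"
    by (rule conj_transpose_mult_left_cancel)
  then show ?thesis
    by (metis conj_transpose_mult conj_transpose_conj_transpose)
qed

text \<open>A linear right inverse of \<open>A\<close> on its range gives \<open>G\<close> with
  \<open>A ** G ** A = A\<close>; then \<open>G ** A ** G\<close> satisfies both equations.\<close>

lemma reflexive_generalized_inverse_exists:
  fixes A :: "'a::field^'n^'m"
  shows "\<exists>G. A ** G ** A = A \<and> G ** A ** G = G"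
proof -
  obtain g where g: "Vector_Spaces.linear (*s) (*s) g" "\<forall>v \<in> range ((*v) A). A *v g v = v"
    using vec.linear_exists_right_inverse_on[OF matrix_vector_mul_linear_gen vec.subspace_UNIV, of A]
    by blast
  define G where "G = matrix g"
  have "(A ** G ** A) *v x = A *v x" for x
    using g by (simp add: G_def matrix_works flip: matrix_vector_mul_assoc)
  then have AGA: "A ** G ** A = A"
    by (simp add: matrix_eq)
  then have "A ** (G ** A ** G) ** A = A"
    "(G ** A ** G) ** A ** (G ** A ** G) = G ** A ** G"
    by (metis matrix_mul_assoc)+
  then show ?thesis
    by blast
qed

lemma col_space_eq_range: "col_space A = range ((*v) A)"
proof
  have "columns A \<subseteq> range ((*v) A)"
  proof
    fix c assume "c \<in> columns A"
    then obtain j where "c = column j A"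
      by (auto simp: columns_def)
    then have "c = A *v axis j 1"
      by (simp add: column_def matrix_vector_mult_def axis_def vec_eq_iff if_distrib cong: if_cong)
    then show "c \<in> range ((*v) A)"
      by blast
  qed
  moreover have "vec.subspace (range ((*v) A))"
    using vec.subspace_UNIV by (rule vec.subspace_image)
  ultimately show "col_space A \<subseteq> range ((*v) A)"
    unfolding col_space_def by (rule vec.span_minimal)
  show "range ((*v) A) \<subseteq> col_space A"
    using matrix_vector_mult_in_columnspace_gen[of A] by (auto simp: col_space_def)
qed

text \<open>Turns inclusions of ranges into matrix equations. If \<open>B ** G ** B = B\<close>,
  then \<open>B ** G\<close> fixes the range of \<open>B\<close>, so \<open>Z = G ** A\<close>
  works.\<close>

lemma col_space_subset_iff: "col_space A \<subseteq> col_space B \<longleftrightarrow> (\<exists>Z. A = B ** Z)"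
proof
  assume sub: "col_space A \<subseteq> col_space B"
  obtain G where G: "B ** G ** B = B"
    using reflexive_generalized_inverse_exists by blast
  have "A *v x = (B ** (G ** A)) *v x" for x
  proof -
    obtain y where "A *v x = B *v y"
      using sub by (auto simp: col_space_eq_range)
    then show ?thesis
      using G by (metis matrix_mul_assoc matrix_vector_mul_assoc)
  qed
  then show "\<exists>Z. A = B ** Z"
    by (metis matrix_eq)
next
  assume "\<exists>Z. A = B ** Z"
  then show "col_space A \<subseteq> col_space B"
    by (auto simp: col_space_eq_range simp flip: matrix_vector_mul_assoc)
qed

section \<open>Orthogonal projectors and the Moore-Penrose inverse\<close>

text \<open>Taking adjoints in \<open>P ** Q = Q\<close> gives \<open>Q ** P = Q\<close>, whereas
  \<open>Q ** P = P\<close>.\<close>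

lemma orthogonal_projector_unique:
  assumes "conj_transpose P = P" "conj_transpose Q = Q" "P ** Q = Q" "Q ** P = P"
  shows "P = Q"
  using assms by (metis conj_transpose_mult)

lemma moore_penrose_ex1:
  fixes A :: "complex^'n^'m"
  shows "\<exists>!X. A ** X ** A = A \<and> X ** A ** X = X \<and>
    conj_transpose (A ** X) = A ** X \<and> conj_transpose (X ** A) = X ** A"
proof (rule ex_ex1I)
  let ?B = "conj_transpose A"
  obtain Y where Y: "(?B ** A ** ?B) ** Y ** (?B ** A ** ?B) = ?B ** A ** ?B"
      "Y ** (?B ** A ** ?B) ** Y = Y"
    using reflexive_generalized_inverse_exists by blast
  \<comment> \<open>Zlobec's formula: any reflexive inverse \<open>Y\<close> of
    \<open>?B ** A ** ?B\<close> yields the Moore-Penrose inverse in this way.\<close>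
  define X where "X = ?B ** Y ** ?B"
  have "?B ** A ** (X ** A ** ?B) = ?B ** A ** ?B"
    using Y(1) by (simp add: X_def matrix_mul_assoc)
  then have "A ** (X ** A ** ?B) = A ** ?B"
    by (rule conj_transpose_mult_left_cancel)
  then have "(A ** X) ** A ** ?B = mat 1 ** A ** ?B"
    by (simp add: matrix_mul_assoc)
  then have AXA: "A ** X ** A = A"
    by (metis conj_transpose_mult_right_cancel matrix_mul_lid)
  have XAX: "X ** A ** X = X"
  proof -
    have "X ** A ** X = ?B ** (Y ** (?B ** A ** ?B) ** Y) ** ?B"
      by (simp add: X_def matrix_mul_assoc)
    then show ?thesis
      using Y(2) by (simp add: X_def)
  qed
  have X': "conj_transpose X = A ** conj_transpose Y ** A"
    by (simp add: X_def conj_transpose_mult matrix_mul_assoc)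
  \<comment> \<open>A product \<open>M ** conj_transpose M\<close> is Hermitian, so this equation
    forces \<open>A ** X\<close> to be Hermitian. The argument for \<open>X ** A\<close> is the
    mirror image.\<close>
  have "A ** X ** conj_transpose (A ** X) = conj_transpose (A ** X)"
    by (simp add: conj_transpose_mult X' matrix_mul_assoc AXA)
  then have 1: "conj_transpose (A ** X) = A ** X"
    by (metis conj_transpose_mult conj_transpose_conj_transpose)
  have "conj_transpose (X ** A) ** (X ** A) = conj_transpose (X ** A)"
  proof -
    have "conj_transpose (X ** A) ** (X ** A) = ?B ** A ** conj_transpose Y ** (A ** X ** A)"
      by (simp add: conj_transpose_mult X' matrix_mul_assoc)
    then show ?thesis
      by (simp add: AXA conj_transpose_mult X' matrix_mul_assoc)
  qed
  then have 2: "conj_transpose (X ** A) = X ** A"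
    by (metis conj_transpose_mult conj_transpose_conj_transpose)
  show "\<exists>X. A ** X ** A = A \<and> X ** A ** X = X \<and>
      conj_transpose (A ** X) = A ** X \<and> conj_transpose (X ** A) = X ** A"
    using AXA XAX 1 2 by blast
next
  fix X Y
  assume X: "A ** X ** A = A \<and> X ** A ** X = X \<and>
      conj_transpose (A ** X) = A ** X \<and> conj_transpose (X ** A) = X ** A"
    and Y: "A ** Y ** A = A \<and> Y ** A ** Y = Y \<and>
      conj_transpose (A ** Y) = A ** Y \<and> conj_transpose (Y ** A) = Y ** A"
  have AX: "A ** X = A ** Y"
  proof (rule orthogonal_projector_unique)
    show "A ** X ** (A ** Y) = A ** Y" "A ** Y ** (A ** X) = A ** X"
      using X Y by (simp_all add: matrix_mul_assoc)
  qed (use X Y in blast)+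
  \<comment> \<open>Swapping the two Hermitian factors under the adjoint brings
    \<open>A ** X ** A\<close> together, which collapses to \<open>A\<close>.\<close>
  have "X ** A = X ** (A ** Y ** A)"
    using Y by simp
  also have "\<dots> = (X ** A) ** (Y ** A)"
    by (simp add: matrix_mul_assoc)
  also have "\<dots> = conj_transpose (X ** A) ** conj_transpose (Y ** A)"
    using X Y by simp
  also have "\<dots> = conj_transpose (Y ** (A ** X ** A))"
    by (simp add: conj_transpose_mult matrix_mul_assoc)
  also have "\<dots> = Y ** A"
    using X Y by simp
  finally have XA: "X ** A = Y ** A" .
  have "X = X ** (A ** X)"
    using X by (simp add: matrix_mul_assoc)
  also have "\<dots> = X ** A ** Y"
    unfolding AX by (rule matrix_mul_assoc)
  also have "\<dots> = Y"
    unfolding XA using Y by blast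
  finally show "X = Y" .
qed

lemma moore_penrose_inverse:
  shows "A ** moore_penrose_inverse A ** A = A"
    and "moore_penrose_inverse A ** A ** moore_penrose_inverse A = moore_penrose_inverse A"
    and "conj_transpose (A ** moore_penrose_inverse A) = A ** moore_penrose_inverse A"
    and "conj_transpose (moore_penrose_inverse A ** A) = moore_penrose_inverse A ** A"
  using theI'[OF moore_penrose_ex1, of A] unfolding moore_penrose_inverse_def by blast+

lemma projector_mult_eq:
  assumes "col_space B \<subseteq> col_space A"
  shows "A ** moore_penrose_inverse A ** B = B"
proof -
  obtain Z where "B = A ** Z"
    using assms unfolding col_space_subset_iff by blast
  then show ?thesis
    using moore_penrose_inverse[of A] by (simp add: matrix_mul_assoc)
qed

text \<open>Each of the two projectors fixes the common range, so they absorb one another.\<close>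

lemma projector_same_range:
  assumes "col_space A = col_space B"
  shows "A ** moore_penrose_inverse A = B ** moore_penrose_inverse B"
  using assms
  by (auto intro!: orthogonal_projector_unique[of "A ** moore_penrose_inverse A"]
      simp: matrix_mul_assoc projector_mult_eq moore_penrose_inverse)

section \<open>Core-invertible matrices\<close>

text \<open>\<open>rank\<close> is the row rank, so the left factorization is immediate; the right one holds because
  \<open>A\<close> acts injectively, hence surjectively, on its own range.\<close>

lemma core_invertible_factors:
  assumes "core_invertible A"
  obtains V W where "A = V ** A ** A" "A = A ** A ** W"
proof -
  have "rank (A ** A) = rank A"
    using assms by (simp add: core_invertible_def numeral_2_eq_2)
  then have "vec.dim (col_space (transpose (A ** A))) = vec.dim (col_space (transpose A))"
    by (simp add: row_rank_def_gen col_space_def)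
  moreover have "col_space (transpose (A ** A)) \<subseteq> col_space (transpose A)"
    by (auto simp: col_space_subset_iff matrix_transpose_mul)
  ultimately have "col_space (transpose A) = col_space (transpose (A ** A))"
    by (metis col_space_def vec.subspace_dim_equal vec.subspace_span order_refl)
  then obtain Z where "transpose A = transpose (A ** A) ** Z"
    by (metis col_space_subset_iff order_refl)
  then have V: "A = transpose Z ** A ** A"
    by (metis matrix_mul_assoc matrix_transpose_mul transpose_transpose)
  have sub: "vec.subspace (range ((*v) A))"
    using vec.subspace_UNIV by (rule vec.subspace_image)
  have "inj_on ((*v) A) (range ((*v) A))"
  proof (rule inj_onI, elim rangeE)
    fix x y u v
    assume "A *v x = A *v y" "x = A *v u" "y = A *v v"
    then have "(transpose Z ** A ** A) *v u = (transpose Z ** A ** A) *v v"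
      by (simp flip: matrix_vector_mul_assoc)
    then show "x = y"
      using V \<open>x = _\<close> \<open>y = _\<close> by simp
  qed
  then have "inj_on ((*v) A) (vec.span (range ((*v) A)))"
    by (simp only: vec.span_eq_iff[THEN iffD2, OF sub])
  then have "vec.dim ((*v) A ` range ((*v) A)) = vec.dim (range ((*v) A))"
    by (rule vec.dim_image_eq[OF matrix_vector_mul_linear_gen])
  then have "(*v) A ` range ((*v) A) = range ((*v) A)"
    by (intro vec.subspace_dim_equal[OF vec.subspace_image[OF sub] sub]) auto
  then have "col_space (A ** A) = col_space A"
    by (simp add: col_space_eq_range image_image flip: matrix_vector_mul_assoc)
  then obtain W where "A = A ** A ** W"
    by (metis col_space_subset_iff order_refl)
  with V show ?thesis
    by (rule that)
qed

text \<open>The witness is \<open>A ** W ** moore_penrose_inverse A\<close>; uniqueness holds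
  because \<open>V\<close> undoes \<open>A\<close> on matrices with columns in the range of
  \<open>A\<close>. Factors are assumed instead of a rank condition since for powers they can be
  written down directly.\<close>

lemma core_inverse_ex1:
  fixes A :: "complex^'n^'n"
  assumes "A = V ** A ** A" "A = A ** A ** W"
  shows "\<exists>!X. A ** X = A ** moore_penrose_inverse A \<and> col_space X \<subseteq> col_space A"
proof (rule ex_ex1I)
  have "A ** (A ** W ** moore_penrose_inverse A) = A ** moore_penrose_inverse A"
    by (simp add: matrix_mul_assoc flip: assms(2))
  moreover have "col_space (A ** W ** moore_penrose_inverse A) \<subseteq> col_space A"
    by (auto simp: col_space_subset_iff simp flip: matrix_mul_assoc)
  ultimately show "\<exists>X. A ** X = A ** moore_penrose_inverse A \<and> col_space X \<subseteq> col_space A"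
    by blast
next
  fix X Y
  assume X: "A ** X = A ** moore_penrose_inverse A \<and> col_space X \<subseteq> col_space A"
    and Y: "A ** Y = A ** moore_penrose_inverse A \<and> col_space Y \<subseteq> col_space A"
  have recover: "V ** (A ** S) = S" if sub: "col_space S \<subseteq> col_space A" for S :: "complex^'n^'n"
  proof -
    obtain Z where "S = A ** Z"
      using sub unfolding col_space_subset_iff by blast
    then show ?thesis
      by (simp only: matrix_mul_assoc flip: assms(1))
  qed
  have "X = V ** (A ** X)"
    using X by (intro recover[symmetric]) blast
  also have "\<dots> = V ** (A ** Y)"
    using X Y by simp
  also have "\<dots> = Y"
    using Y by (intro recover) blast
  finally show "X = Y" .
qed

lemma core_inverse:
  assumes "A = V ** A ** A" "A = A ** A ** W"
  shows "A ** core_inverse A = A ** moore_penrose_inverse A"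
    and "col_space (core_inverse A) \<subseteq> col_space A"
  using theI'[OF core_inverse_ex1[OF assms]] unfolding core_inverse_def by blast+

section \<open>Powers along the core-EP decomposition\<close>

lemma mat_pow_add: "mat_pow A (m + n) = mat_pow A m ** mat_pow A n"
  by (induction m) (simp_all add: matrix_mul_assoc)

lemma mat_pow_Suc_right: "mat_pow A (Suc m) = mat_pow A m ** A"
  using mat_pow_add[of A m 1] by simp

text \<open>In the expansion of the power, every word with \<open>A2\<close> immediately before
  \<open>A1\<close> vanishes, so each surviving word other than the pure power of \<open>A2\<close>
  starts with \<open>A1\<close>.\<close>

lemma mat_pow_add_eq_mult_add_pow:
  assumes "A2 ** A1 = 0"
  shows "\<exists>U. mat_pow (A1 + A2) m = A1 ** U + mat_pow A2 m"
proof (induction m)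
  case 0
  show ?case
    by (rule exI[of _ 0]) simp
next
  case (Suc m)
  then obtain U where U: "mat_pow (A1 + A2) m = A1 ** U + mat_pow A2 m"
    by blast
  have "A2 ** (A1 ** U) = 0"
    using assms by (simp add: matrix_mul_assoc)
  then have "mat_pow (A1 + A2) (Suc m) = A1 ** (A1 ** U + mat_pow A2 m) + mat_pow A2 (Suc m)"
    by (simp add: U matrix_add_ldistrib matrix_add_rdistrib)
  then show ?case
    by blast
qed

lemma mat_pow_mult_core_part:
  assumes "A2 ** A1 = 0"
  shows "mat_pow (A1 + A2) m ** A1 = mat_pow A1 (Suc m)"
proof (induction m)
  case (Suc m)
  have "mat_pow (A1 + A2) (Suc m) ** A1 = (A1 + A2) ** (A1 ** mat_pow A1 m)"
    using Suc by (simp flip: matrix_mul_assoc)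
  also have "\<dots> = A1 ** (A1 ** mat_pow A1 m)"
    using assms by (simp add: matrix_add_rdistrib matrix_mul_assoc)
  finally show ?case
    by simp
qed simp

text \<open>The innermost \<open>V ** A ** A\<close>, respectively \<open>A ** A ** W\<close>,
  contracts to \<open>A\<close> and lowers both exponents by one.\<close>

lemma core_invertible_pow_factors:
  assumes "A = V ** A ** A" "A = A ** A ** W"
  shows "A = mat_pow V m ** mat_pow A (Suc m)" "A = mat_pow A (Suc m) ** mat_pow W m"
proof -
  show "A = mat_pow V m ** mat_pow A (Suc m)"
  proof (induction m)
    case (Suc m)
    have "mat_pow V (Suc m) ** mat_pow A (Suc (Suc m)) =
        mat_pow V m ** (V ** A ** A) ** mat_pow A m"
      unfolding mat_pow_Suc_right[of V] by (simp add: matrix_mul_assoc)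
    then show ?case
      using Suc assms(1) by (simp add: matrix_mul_assoc)
  qed simp
  show "A = mat_pow A (Suc m) ** mat_pow W m"
  proof (induction m)
    case (Suc m)
    have "mat_pow A (Suc (Suc m)) ** mat_pow W (Suc m) =
        mat_pow A m ** (A ** A ** W) ** mat_pow W m"
      unfolding mat_pow_Suc_right[of A] by (simp add: matrix_mul_assoc)
    then show ?case
      using Suc assms(2) by (metis mat_pow_Suc_right)
  qed simp
qed

text \<open>The \<open>LEAST\<close> in \<^const>\<open>mat_index\<close> is junk without a witness; core-invertibility makes 1 one.\<close>

lemma core_invertible_index_0:
  assumes "core_invertible A" "mat_index A = 0"
  shows "invertible A"
proof (rule ccontr)
  let ?P = "\<lambda>k. 0 < k \<and> rank (mat_pow A (k + 1)) = rank (mat_pow A k)"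
  assume "\<not> invertible A"
  moreover have "?P 1"
    using assms(1) by (simp add: core_invertible_def numeral_2_eq_2)
  then have "?P (LEAST k. ?P k)"
    by (rule LeastI)
  ultimately show False
    using assms(2) by (simp add: mat_index_def)
qed

text \<open>For positive index the power of \<open>A2\<close> vanishes. For index 0 the power is the
  identity, and \<open>A = A1\<close> is invertible, so \<open>U\<close> is its inverse.\<close>

lemma core_EP_index_pow:
  assumes "core_EP_decomposition A A1 A2"
  shows "\<exists>U. mat_pow A (mat_index A) = A1 ** U"
proof (cases "mat_index A = 0")
  case True
  then have "A1 = A" "core_invertible A"
    using assms by (auto simp: core_EP_decomposition_def)
  then obtain U where "A ** U = mat 1"
    using True core_invertible_index_0 unfolding invertible_def by blast
  then show ?thesis
    using True \<open>A1 = A\<close> by (intro exI[of _ U]) simp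
next
  case False
  then show ?thesis
    using assms mat_pow_add_eq_mult_add_pow[of A2 A1 "mat_index A"]
    by (auto simp: core_EP_decomposition_def)
qed

section \<open>The core-EP inverse and the projector onto the range of the core part\<close>

theorem corollary3p4:
  fixes A A1 A2 :: "complex^'n^'n" and k :: nat
  assumes "core_EP_decomposition A A1 A2"
    and "k = mat_index A"
  shows "core_EP_inverse A = mat_pow A k ** core_inverse (mat_pow A (k + 1)) \<and>
    A ** core_EP_inverse A = mat_pow A k ** core_inverse (mat_pow A k) \<and>
    mat_pow A k ** core_inverse (mat_pow A k) = mat_pow A k ** moore_penrose_inverse (mat_pow A k) \<and>
    A1 = A ** core_EP_inverse A ** A \<and>
    A2 = A - A ** core_EP_inverse A ** A"
proof -
  have A: "A = A1 + A2" and core: "core_invertible A1" and orth: "conj_transpose A1 ** A2 = 0"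
    and A21: "A2 ** A1 = 0"
    using assms(1) by (auto simp: core_EP_decomposition_def)
  obtain V W where VW: "A1 = V ** A1 ** A1" "A1 = A1 ** A1 ** W"
    using core by (rule core_invertible_factors)
  obtain U where U: "mat_pow A k = A1 ** U"
    using core_EP_index_pow[OF assms(1)] assms(2) by blast
  have pow_A1: "mat_pow A m ** A1 = mat_pow A1 (Suc m)" for m
    using mat_pow_mult_core_part[OF A21] A by simp

  \<comment> \<open>\<open>V\<close> comes from \<open>A1\<close> but also cancels factors
    \<open>A\<close> in front of \<open>mat_pow A k\<close>, because there they act as factors
    \<open>A1\<close>.\<close>
  have left: "mat_pow V m ** mat_pow A (m + k) = mat_pow A k" for m
  proof -
    have "mat_pow V m ** mat_pow A (m + k) = mat_pow V m ** (mat_pow A m ** A1) ** U"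
      by (simp add: mat_pow_add U matrix_mul_assoc)
    also have "\<dots> = mat_pow A k"
      by (simp only: pow_A1 U flip: core_invertible_pow_factors(1)[OF VW])
    finally show ?thesis .
  qed
  have A1_factor: "A1 = mat_pow A m ** (A1 ** mat_pow W m)" for m
    using core_invertible_pow_factors(2)[OF VW, of m] by (simp only: matrix_mul_assoc pow_A1)
  have space: "col_space (mat_pow A (m + k)) = col_space A1" for m
  proof
    have "mat_pow A (m + k) = mat_pow A m ** A1 ** U"
      by (simp add: mat_pow_add U matrix_mul_assoc)
    also have "\<dots> = A1 ** (mat_pow A1 m ** U)"
      by (simp add: pow_A1 matrix_mul_assoc)
    finally show "col_space (mat_pow A (m + k)) \<subseteq> col_space A1"
      unfolding col_space_subset_iff by blast
    \<comment> \<open>\<open>A1_factor\<close> is used with exponent \<open>m + k\<close>.\<close>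
    show "col_space A1 \<subseteq> col_space (mat_pow A (m + k))"
      using A1_factor unfolding col_space_subset_iff by blast
  qed

  define P where "P = A1 ** moore_penrose_inverse A1"
  have proj: "mat_pow A (m + k) ** moore_penrose_inverse (mat_pow A (m + k)) = P" for m
    unfolding P_def by (rule projector_same_range) (rule space)
  have P_herm: "conj_transpose P = P"
    unfolding P_def by (rule moore_penrose_inverse)
  have P_fix: "P ** mat_pow A (m + k) = mat_pow A (m + k)" for m
    by (simp add: projector_mult_eq flip: proj[of m])
  have "P ** A2 = conj_transpose P ** A2"
    by (simp add: P_herm)
  also have "\<dots> = conj_transpose (moore_penrose_inverse A1) ** (conj_transpose A1 ** A2)"
    by (simp add: P_def conj_transpose_mult matrix_mul_assoc)
  finally have "P ** A2 = 0"
    by (simp add: orth)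
  moreover have "P ** A1 = A1"
    unfolding P_def by (rule moore_penrose_inverse)
  ultimately have PA: "P ** A = A1"
    by (simp add: A matrix_add_ldistrib)

  have core_inv: "mat_pow A (m + k) ** core_inverse (mat_pow A (m + k)) = P" for m
  proof -
    let ?B = "mat_pow A (m + k)"
    \<comment> \<open>The exponent is split so that \<open>left\<close> with
      \<open>m + k + m\<close> reduces the square to \<open>mat_pow A k\<close>; the factor
      \<open>mat_pow A m\<close> then restores \<open>?B\<close>. This gives the left factor, and
      equality of column spaces gives the right one.\<close>
    have double: "?B ** ?B = mat_pow A ((m + k + m) + k)"
      by (simp add: add.assoc flip: mat_pow_add)
    have "mat_pow A m ** mat_pow V (m + k + m) ** (?B ** ?B) = ?B"
      by (simp only: double left flip: matrix_mul_assoc) (simp add: mat_pow_add)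
    then have "?B = mat_pow A m ** mat_pow V (m + k + m) ** ?B ** ?B"
      by (simp add: matrix_mul_assoc)
    moreover obtain Z where "?B = ?B ** ?B ** Z"
      using space[of m] space[of "m + k + m"] double col_space_subset_iff by (metis order_refl)
    ultimately have "?B ** core_inverse ?B = ?B ** moore_penrose_inverse ?B"
      by (rule core_inverse)
    then show ?thesis
      by (simp only: proj)
  qed

  let ?B = "mat_pow A k" and ?C = "mat_pow A (k + 1)"
  have C: "?C = A ** ?B"
    by simp
  \<comment> \<open>Since \<open>V ** ?C = ?B\<close>, an identity with left factor
    \<open>?B\<close> may be checked after multiplying by \<open>A\<close>, where
    \<open>?C ** core_inverse ?C = P\<close> is available.\<close>
  have cancel: "?B ** S = ?B ** T" if "?C ** S = ?C ** T" for S T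
  proof -
    have VC: "?B = mat_pow V 1 ** ?C"
      using left[of 1] by simp
    show ?thesis
      unfolding VC using that by (simp only: flip: matrix_mul_assoc)
  qed
  define X where "X = ?B ** core_inverse ?C"
  have AX: "A ** X = P"
    using core_inv[of 1] by (simp add: X_def matrix_mul_assoc)
  have PP: "P ** P = P"
    by (simp add: P_def matrix_mul_assoc moore_penrose_inverse)
  have "core_EP_inverse A = X"
    unfolding core_EP_inverse_def assms(2)[symmetric]
  proof (rule the_equality)
    have "?C ** (core_inverse ?C ** ?C) = ?C ** mat 1"
      using core_inv[of 1] P_fix[of 1] by (simp add: matrix_mul_assoc)
    then have "X ** ?C = ?B"
      using cancel by (fastforce simp: X_def simp flip: matrix_mul_assoc)
    moreover have "?C ** (core_inverse ?C ** P) = ?C ** core_inverse ?C"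
      using core_inv[of 1] PP by (simp add: matrix_mul_assoc)
    then have "X ** A ** X = X"
      using cancel AX by (fastforce simp: X_def simp flip: matrix_mul_assoc)
    ultimately show "X ** ?C = ?B \<and> X ** A ** X = X \<and>
        conj_transpose (A ** X) = A ** X \<and> col_space X \<subseteq> col_space ?B"
      using AX P_herm by (auto simp: col_space_subset_iff X_def)
  next
    fix Y
    assume Y: "Y ** ?C = ?B \<and> Y ** A ** Y = Y \<and>
        conj_transpose (A ** Y) = A ** Y \<and> col_space Y \<subseteq> col_space ?B"
    then obtain Z where Z: "Y = ?B ** Z"
      by (auto simp: col_space_subset_iff)
    \<comment> \<open>\<open>A ** Y\<close> fixes \<open>?C\<close>, hence the range of
      \<open>P\<close>. With the converse absorption the two projectors agree, and
      \<open>cancel\<close> recovers \<open>Y\<close> from \<open>A ** Y\<close>.\<close>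
    have "A ** Y ** P = P"
    proof -
      have "A ** (Y ** ?C) = ?C"
        using Y C by simp
      moreover have "P = ?C ** core_inverse ?C"
        using core_inv[of 1] by simp
      ultimately show ?thesis
        by (simp only: matrix_mul_assoc)
    qed
    moreover have "P ** (A ** Y) = A ** Y"
      using P_fix[of 1] by (simp add: Z matrix_mul_assoc)
    ultimately have "A ** Y = P"
      using Y P_herm orthogonal_projector_unique by blast
    then have "?C ** Z = ?C ** core_inverse ?C"
      using core_inv[of 1] by (simp add: Z matrix_mul_assoc)
    then show "Y = X"
      using cancel Z X_def by blast
  qed
  then show ?thesis
    using AX PA A X_def core_inv[of 0] proj[of 0] by simp
qed

end
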